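(* Let $V$ be a locally convex topological vector space, let $p$ be an element of a convex subset $C$ of $V$, and let $v\in V$. Assume that $v$ and $C$ are contained in a subset $X$ of $V$ (that is, $v\in X$ and $C\subseteq X$) such that there is a norm on $X$ that induces the topology that $X$ inherits from $V$. Assume additionally that $X$ contains the intersection of the tangent cone of $C$ at $p$ with an open subset of $V$ that contains $v$. Then there is a curve $c\colon[0,+\infty)\to C$ such that $$c(0)=p\quad\text{and}\quad \left.\frac{dc(t)}{dt}\right|_{t=0+}=v$$ if, and only if, $\theta(v)\geq 0$ for all $\theta\in V^*$ for which $\theta(p)=\inf_{q\in C}\theta(q)$, that is, for all continuous linear functionals $\theta$ that attain their minimum within $C$ at $p$.
   Context: Vector spaces are real; $V^*$ denotes the topological dual of $V$. A curve is a continuous map. The tangent cone of $C$ at $p$ is the set of vectors $w\in V$ such that $p+tw\in C$ for some $t>0$, i.e. the set $\mathbb{R}_{>0}(C-p)$. The set $X$ is only a subset of $V$, not necessarily a linear subspace; "a norm on $X$ that induces the topology that $X$ inherits from $V$" means a norm $\|\cdot\|$ on the linear span of $X$ such that the metric $(x,y)\mapsto\|x-y\|$ restricted to $X$ induces on $X$ the subspace topology inherited from $V$. The one-sided derivative is $\left.\frac{dc(t)}{dt}\right|_{t=0+}=\lim_{t\to0+}\frac{c(t)-c(0)}{t}$, the limit being taken in the topology of $V$. *)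

theory Defs
  imports "HOL-Analysis.Analysis"
begin

text \<open>Topological vector spaces are not required to be Hausdorff.\<close>

class topological_real_vector = real_vector + topological_ab_group_add +
  assumes tendsto_scaleR_Pair:
    "LIM z (nhds a \<times>\<^sub>F nhds x). fst z *\<^sub>R snd z :> nhds (a *\<^sub>R x)"

text \<open>The class assumption has the library predicates \<^const>\<open>convex\<close> and \<^const>\<open>interior\<close>
  unfolded, since their sort constraints exclude them from a class specification;
  \<open>convex_nhds_zero\<close> below restates it.\<close>

class locally_convex_space = topological_real_vector +
  assumes convex_nhds_zero_raw:
    "open U \<Longrightarrow> 0 \<in> U \<Longrightarrow>
      \<exists>W. (\<forall>x\<in>W. \<forall>y\<in>W. \<forall>a\<ge>0. \<forall>b\<ge>0. a + b = 1 \<longrightarrow> a *\<^sub>R x + b *\<^sub>R y \<in> W) \<and>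
          (\<exists>T. open T \<and> 0 \<in> T \<and> T \<subseteq> W) \<and> W \<subseteq> U"

lemma convex_nhds_zero:
  fixes U :: "'a::locally_convex_space set"
  assumes "open U" "0 \<in> U"
  shows "\<exists>W. convex W \<and> 0 \<in> interior W \<and> W \<subseteq> U"
  using convex_nhds_zero_raw[OF assms] unfolding convex_def interior_def by blast

definition topological_dual :: "('a::topological_real_vector \<Rightarrow> real) set" where
  "topological_dual = {\<theta>. linear \<theta> \<and> continuous_on UNIV \<theta>}"

text \<open>Neither \<open>0 < t\<close> is relaxed nor is a closure taken: this is the set of all positive
  multiples of elements of \<open>C - p\<close>.\<close>

definition tangent_cone :: "'a::real_vector set \<Rightarrow> 'a \<Rightarrow> 'a set" where
  "tangent_cone C p = {w. \<exists>t>0. p + t *\<^sub>R w \<in> C}"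

definition norm_on :: "'a::real_vector set \<Rightarrow> ('a \<Rightarrow> real) \<Rightarrow> bool" where
  "norm_on S N \<longleftrightarrow>
     (\<forall>x\<in>S. 0 \<le> N x) \<and>
     (\<forall>x\<in>S. N x = 0 \<longleftrightarrow> x = 0) \<and>
     (\<forall>a. \<forall>x\<in>S. N (a *\<^sub>R x) = \<bar>a\<bar> * N x) \<and>
     (\<forall>x\<in>S. \<forall>y\<in>S. N (x + y) \<le> N x + N y)"

text \<open>The metric of the norm, restricted to \<open>X\<close>. It is totalized outside \<open>X\<close> because the
  locale \<^const>\<open>Metric_space\<close> asks for symmetry and nonnegativity everywhere;
  \<open>norm_inducing_iff\<close> below spells out the condition that results.\<close>

definition norm_dist :: "'a::real_vector set \<Rightarrow> ('a \<Rightarrow> real) \<Rightarrow> 'a \<Rightarrow> 'a \<Rightarrow> real" where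
  "norm_dist X N x y = (if x \<in> X \<and> y \<in> X then N (x - y) else 0)"

definition norm_inducing :: "'a::{real_vector,topological_space} set \<Rightarrow> ('a \<Rightarrow> real) \<Rightarrow> bool" where
  "norm_inducing X N \<longleftrightarrow>
     norm_on (span X) N \<and> Metric_space.mtopology X (norm_dist X N) = top_of_set X"

lemma Metric_space_norm_dist:
  assumes "norm_on (span X) N"
  shows "Metric_space X (norm_dist X N)"
proof
  have N: "0 \<le> N u" "N u = 0 \<longleftrightarrow> u = 0" "N (a *\<^sub>R u) = \<bar>a\<bar> * N u"
    "w \<in> span X \<Longrightarrow> N (u + w) \<le> N u + N w"
    if "u \<in> span X" for u w a
    using assms that by (simp_all add: norm_on_def)
  have diff: "u - w \<in> span X" if "u \<in> X" "w \<in> X" for u w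
    by (rule span_diff[OF span_base[OF that(1)] span_base[OF that(2)]])
  fix x y
  show "0 \<le> norm_dist X N x y"
    unfolding norm_dist_def by (simp add: N(1)[OF diff])
  show "norm_dist X N x y = norm_dist X N y x"
  proof (cases "x \<in> X \<and> y \<in> X")
    case True
    then have "N ((-1) *\<^sub>R (x - y)) = \<bar>-1\<bar> * N (x - y)"
      by (intro N(3) diff) simp_all
    then have "N (y - x) = N (x - y)" by simp
    then show ?thesis by (simp add: norm_dist_def)
  qed (auto simp: norm_dist_def)
  assume xy: "x \<in> X" "y \<in> X"
  then show "norm_dist X N x y = 0 \<longleftrightarrow> x = y"
    by (simp add: norm_dist_def N(2)[OF diff])
  fix z assume z: "z \<in> X"
  have "N ((x - y) + (y - z)) \<le> N (x - y) + N (y - z)"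
    by (rule N(4)[OF diff[OF xy] diff[OF xy(2) z]])
  then show "norm_dist X N x z \<le> norm_dist X N x y + norm_dist X N y z"
    using xy z by (simp add: norm_dist_def)
qed

lemma norm_inducing_iff:
  "norm_inducing X N \<longleftrightarrow>
     norm_on (span X) N \<and>
     (\<forall>U\<subseteq>X. openin (top_of_set X) U \<longleftrightarrow> (\<forall>x\<in>U. \<exists>e>0. \<forall>y\<in>X. N (x - y) < e \<longrightarrow> y \<in> U))"
proof (cases "norm_on (span X) N")
  case True
  interpret M: Metric_space X "norm_dist X N"
    by (rule Metric_space_norm_dist[OF True])
  have mopen: "openin M.mtopology U \<longleftrightarrow>
      U \<subseteq> X \<and> (\<forall>x\<in>U. \<exists>e>0. \<forall>y\<in>X. N (x - y) < e \<longrightarrow> y \<in> U)" for U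
  proof (cases "U \<subseteq> X")
    case True
    have "M.mball x e \<subseteq> U \<longleftrightarrow> (\<forall>y\<in>X. N (x - y) < e \<longrightarrow> y \<in> U)" if "x \<in> U" for x e
      using that True by (auto simp: norm_dist_def subset_iff)
    then show ?thesis
      using True by (simp only: M.openin_mtopology Ball_def simp_thms cong: imp_cong)
  qed (simp add: M.openin_mtopology)
  have "M.mtopology = top_of_set X \<longleftrightarrow>
      (\<forall>U. openin (top_of_set X) U \<longleftrightarrow>
        U \<subseteq> X \<and> (\<forall>x\<in>U. \<exists>e>0. \<forall>y\<in>X. N (x - y) < e \<longrightarrow> y \<in> U))"
    unfolding topology_eq mopen by (rule all_cong1) (rule eq_commute)
  also have "\<dots> \<longleftrightarrow> (\<forall>U\<subseteq>X. openin (top_of_set X) U \<longleftrightarrow>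
        (\<forall>x\<in>U. \<exists>e>0. \<forall>y\<in>X. N (x - y) < e \<longrightarrow> y \<in> U))"
  proof -
    have *: "A = (U \<subseteq> X \<and> B) \<longleftrightarrow> (U \<subseteq> X \<longrightarrow> A = B)" if "A \<Longrightarrow> U \<subseteq> X" for A B U
      using that by blast
    show ?thesis
      by (rule all_cong1, rule *, rule openin_imp_subset)
  qed
  finally show ?thesis
    unfolding norm_inducing_def by (rule conj_cong[OF refl])
qed (simp add: norm_inducing_def)

end

theory Submission
  imports Defs
begin

text \<open>
  The tangent cone \<open>K\<close> of \<open>C\<close> at \<open>p\<close> is a convex cone containing \<open>0\<close>, and a continuous linear
  functional attains its minimum over \<open>C\<close> at \<open>p\<close> exactly if it is nonnegative on \<open>K\<close>. By the
  Hahn-Banach theorem (\<open>separate_convex_cone\<close>) the condition on functionals therefore says that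
  \<open>v\<close> lies in the closure of \<open>K\<close>. So the theorem claims that a vector in the closure of \<open>K\<close> is the
  initial velocity of a curve in \<open>C\<close>; the converse is immediate, because a functional that is
  minimal at \<open>p\<close> is nonnegative on all difference quotients.

  The norm on \<open>X\<close> is what makes closures accessible by sequences: since \<open>X\<close>
  contains \<open>v\<close> and the part of \<open>K\<close> near \<open>v\<close>, it provides a sequence \<open>w\<close> in \<open>K\<close> converging to \<open>v\<close>
  (\<open>closure_sequence_of_norm_inducing\<close>). By convexity of \<open>C\<close>, the points \<open>p + t *\<^sub>R w n\<close> belong to
  \<open>C\<close> for all sufficiently small \<open>t\<close>, say for \<open>t \<le> \<tau> n\<close>. Choose \<open>s n\<close> decreasing to \<open>0\<close> so fast
  that \<open>s n\<close> is at most \<open>\<tau> n\<close> and \<open>\<tau> (Suc n)\<close>, and let \<open>u\<close> be the piecewise linear path that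
  moves from \<open>w (Suc n)\<close> to \<open>w n\<close> while \<open>t\<close> runs from \<open>s (Suc n)\<close> to \<open>s n\<close>
  (\<open>piecewise_linear_interpolation\<close>). By local convexity \<open>u t\<close> tends to \<open>v\<close> as \<open>t\<close> decreases to
  \<open>0\<close> (\<open>tendsto_interpolation\<close>), and the curve is \<open>p + t *\<^sub>R u t\<close>, held constant from \<open>t = s 0\<close> on.
\<close>

section \<open>Limits in topological vector spaces\<close>

lemma tendsto_scaleR_tvs:
  fixes g :: "'b \<Rightarrow> 'a::topological_real_vector"
  assumes "(f \<longlongrightarrow> a) F" and "(g \<longlongrightarrow> x) F"
  shows "((\<lambda>t. f t *\<^sub>R g t) \<longlongrightarrow> a *\<^sub>R x) F"
  using filterlim_compose[OF tendsto_scaleR_Pair filterlim_Pair[OF assms]] by simp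

lemma continuous_on_scaleR_tvs:
  fixes g :: "'b::topological_space \<Rightarrow> 'a::topological_real_vector"
  assumes "continuous_on S f" and "continuous_on S g"
  shows "continuous_on S (\<lambda>t. f t *\<^sub>R g t)"
  using assms unfolding continuous_on_def by (blast intro: tendsto_scaleR_tvs)

lemma convex_translate_nhds:
  fixes v :: "'a::locally_convex_space"
  assumes "open T" "v \<in> T"
  obtains W where "convex W" "0 \<in> interior W" "\<And>w. w \<in> W \<Longrightarrow> v + w \<in> T"
proof -
  have "open ((+) v -` T)"
    by (rule open_vimage[OF assms(1)]) (intro continuous_intros)
  moreover have "0 \<in> (+) v -` T"
    using assms(2) by simp
  ultimately show thesis
    using that convex_nhds_zero[of "(+) v -` T"] by blast
qed

text \<open>By additivity, continuity at \<open>0\<close> suffices; there it holds because \<open>f\<close> is at most \<open>e\<close> in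
  absolute value on the symmetric neighbourhood \<open>e *\<^sub>R (W \<inter> - W)\<close>.\<close>

lemma continuous_on_linear_bounded_above_nhds:
  fixes f :: "'a::topological_real_vector \<Rightarrow> real"
  assumes lin: "linear f" and W: "0 \<in> interior W" and le: "\<And>w. w \<in> W \<Longrightarrow> f w \<le> 1"
  shows "continuous_on UNIV f"
proof -
  have "(f \<longlongrightarrow> f a) (at a)" for a
  proof -
    have "\<forall>\<^sub>F x in at a. dist (f x) (f a) < e" if "e > 0" for e
    proof -
      have ev: "\<forall>\<^sub>F x in at a. r *\<^sub>R (x - a) \<in> interior W" for r
      proof (rule topological_tendstoD)
        have "((\<lambda>x. x - a) \<longlongrightarrow> a - a) (at a)"
          by (intro tendsto_intros)
        from tendsto_scaleR_tvs[OF tendsto_const[of r] this]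
        show "((\<lambda>x. r *\<^sub>R (x - a)) \<longlongrightarrow> 0) (at a)"
          by simp
      qed (use W in auto)
      show ?thesis
        using ev[of "2 / e"] ev[of "- (2 / e)"]
      proof eventually_elim
        case (elim x)
        then have "f ((2 / e) *\<^sub>R (x - a)) \<le> 1" "f ((- (2 / e)) *\<^sub>R (x - a)) \<le> 1"
          by (auto intro!: le elim: interior_subset[THEN subsetD])
        then have "(2 / e) * (f x - f a) \<le> 1" "(- (2 / e)) * (f x - f a) \<le> 1"
          unfolding linear_scale[OF lin] linear_diff[OF lin] by simp_all
        then have "2 * \<bar>f x - f a\<bar> \<le> e"
          using that by (auto simp: field_simps abs_if)
        then show ?case
          using that by (simp add: dist_real_def)
      qed
    qed
    then show ?thesis
      unfolding tendsto_iff by blast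
  qed
  then show ?thesis
    by (simp add: continuous_on_def)
qed

section \<open>The Hahn-Banach theorem for sublinear functionals\<close>

definition sublinear :: "('a::real_vector \<Rightarrow> real) \<Rightarrow> bool" where
  "sublinear f \<longleftrightarrow> (\<forall>x y. f (x + y) \<le> f x + f y) \<and> (\<forall>r>0. \<forall>x. f (r *\<^sub>R x) = r * f x)"

lemma sublinear_add: "sublinear f \<Longrightarrow> f (x + y) \<le> f x + f y"
  by (simp add: sublinear_def)

lemma sublinear_scale_pos: "sublinear f \<Longrightarrow> 0 < r \<Longrightarrow> f (r *\<^sub>R x) = r * f x"
  by (simp add: sublinear_def)

lemma sublinear_zero:
  assumes "sublinear f" shows "f 0 = 0"
  using sublinear_scale_pos[OF assms, of 2 0] by simp

lemma sublinear_scale: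
  assumes "sublinear f" "0 \<le> r" shows "f (r *\<^sub>R x) = r * f x"
  using assms by (cases "r = 0") (simp_all add: sublinear_zero sublinear_scale_pos)

lemma sublinear_neg_le:
  assumes "sublinear f" shows "- f (- x) \<le> f x"
  using sublinear_add[OF assms, of x "- x"] sublinear_zero[OF assms] by simp

text \<open>All sublinear functionals below arise as infima: the infimum of a chain, the decrease of a
  functional along a direction, and the gauge of a neighbourhood modulo a cone. This is the
  common reason why they are sublinear.\<close>

lemma sublinear_Inf:
  fixes A :: "'a::real_vector \<Rightarrow> real set"
  assumes ne: "\<And>x. A x \<noteq> {}" and bdd: "\<And>x. bdd_below (A x)"
    and add: "\<And>x y a b. a \<in> A x \<Longrightarrow> b \<in> A y \<Longrightarrow> \<exists>c\<in>A (x + y). c \<le> a + b"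
    and scale: "\<And>x a r. a \<in> A x \<Longrightarrow> 0 < r \<Longrightarrow> \<exists>c\<in>A (r *\<^sub>R x). c \<le> r * a"
  shows "sublinear (\<lambda>x. Inf (A x))"
  unfolding sublinear_def
proof (intro conjI allI impI)
  fix x y
  have "Inf (A (x + y)) - a \<le> Inf (A y)" if "a \<in> A x" for a
  proof (rule cInf_greatest[OF ne])
    fix b assume "b \<in> A y"
    from add[OF \<open>a \<in> A x\<close> this] obtain c where "c \<in> A (x + y)" "c \<le> a + b"
      by blast
    then show "Inf (A (x + y)) - a \<le> b"
      using cInf_lower[OF _ bdd] by fastforce
  qed
  then have "Inf (A (x + y)) - Inf (A y) \<le> a" if "a \<in> A x" for a
    using that by fastforce
  from cInf_greatest[OF ne this]
  show "Inf (A (x + y)) \<le> Inf (A x) + Inf (A y)"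
    by fastforce
next
  have le: "Inf (A (r *\<^sub>R x)) \<le> r * Inf (A x)" if r: "0 < r" for r x
  proof -
    have "Inf (A (r *\<^sub>R x)) / r \<le> Inf (A x)"
    proof (rule cInf_greatest[OF ne])
      fix a assume "a \<in> A x"
      then obtain c where "c \<in> A (r *\<^sub>R x)" "c \<le> r * a"
        using scale[OF _ r] by blast
      then have "Inf (A (r *\<^sub>R x)) \<le> r * a"
        using cInf_lower[OF _ bdd] by fastforce
      then show "Inf (A (r *\<^sub>R x)) / r \<le> a"
        using that by (simp add: field_simps)
    qed
    then show ?thesis
      using that by (simp add: field_simps)
  qed
  fix r :: real and x
  assume r: "0 < r"
  have "Inf (A (inverse r *\<^sub>R r *\<^sub>R x)) \<le> inverse r * Inf (A (r *\<^sub>R x))"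
    using r by (intro le) simp
  then have "r * Inf (A x) \<le> Inf (A (r *\<^sub>R x))"
    using r by (simp add: field_simps)
  with le[OF r, of x] show "Inf (A (r *\<^sub>R x)) = r * Inf (A x)"
    by simp
qed

text \<open>Replacing \<open>f\<close> by the infimum of \<open>f (x + t *\<^sub>R y) - t * f y\<close> over \<open>t \<ge> 0\<close> keeps it sublinear
  and makes it as small as possible at \<open>- y\<close>: a sublinear functional below \<open>f\<close> cannot be less
  than \<open>- f y\<close> there.\<close>

lemma sublinear_decrease:
  assumes f: "sublinear f"
  obtains g where "sublinear g" "\<And>x. g x \<le> f x" "\<And>x. g x \<le> f (x + y) - f y" "g (- y) \<le> - f y"
proof -
  define A where "A x = {f (x + t *\<^sub>R y) - t * f y | t. 0 \<le> t}" for x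
  have bdd: "bdd_below (A x)" for x
  proof (rule bdd_belowI)
    fix a assume "a \<in> A x"
    then obtain t where t: "0 \<le> t" "a = f (x + t *\<^sub>R y) - t * f y"
      by (auto simp: A_def)
    have "f (t *\<^sub>R y) \<le> f (x + t *\<^sub>R y) + f (- x)"
      using sublinear_add[OF f, of "x + t *\<^sub>R y" "- x"] by simp
    then show "- f (- x) \<le> a"
      using t by (simp add: sublinear_scale[OF f])
  qed
  have mem: "f (x + t *\<^sub>R y) - t * f y \<in> A x" if "0 \<le> t" for x t
    using that by (auto simp: A_def)
  have lower: "Inf (A x) \<le> f (x + t *\<^sub>R y) - t * f y" if "0 \<le> t" for x t
    by (rule cInf_lower[OF mem[OF that] bdd])
  show thesis
  proof
    show "sublinear (\<lambda>x. Inf (A x))"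
    proof (rule sublinear_Inf[OF _ bdd])
      show "A x \<noteq> {}" for x
        using mem[of 0 x] by auto
    next
      fix x x' a a' assume "a \<in> A x" "a' \<in> A x'"
      then obtain t t' where t: "0 \<le> t" "a = f (x + t *\<^sub>R y) - t * f y"
        "0 \<le> t'" "a' = f (x' + t' *\<^sub>R y) - t' * f y"
        by (auto simp: A_def)
      show "\<exists>c\<in>A (x + x'). c \<le> a + a'"
      proof (rule bexI)
        show "f (x + x' + (t + t') *\<^sub>R y) - (t + t') * f y \<in> A (x + x')"
          using t by (intro mem) simp
        show "f (x + x' + (t + t') *\<^sub>R y) - (t + t') * f y \<le> a + a'"
          using sublinear_add[OF f, of "x + t *\<^sub>R y" "x' + t' *\<^sub>R y"] t
          by (simp add: algebra_simps)
      qed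
    next
      fix x a and r :: real assume "a \<in> A x" and r: "0 < r"
      then obtain t where t: "0 \<le> t" "a = f (x + t *\<^sub>R y) - t * f y"
        by (auto simp: A_def)
      show "\<exists>c\<in>A (r *\<^sub>R x). c \<le> r * a"
      proof (rule bexI)
        show "f (r *\<^sub>R x + (r * t) *\<^sub>R y) - (r * t) * f y \<in> A (r *\<^sub>R x)"
          using t r by (intro mem) simp
        show "f (r *\<^sub>R x + (r * t) *\<^sub>R y) - (r * t) * f y \<le> r * a"
          unfolding t(2) using sublinear_scale_pos[OF f r, of "x + t *\<^sub>R y"]
          by (simp add: algebra_simps)
      qed
    qed
    show "Inf (A x) \<le> f x" for x
      using lower[of 0 x] by simp
    show le: "Inf (A x) \<le> f (x + y) - f y" for x
      using lower[of 1 x] by simp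
    show "Inf (A (- y)) \<le> - f y"
      using le[of "- y"] sublinear_zero[OF f] by simp
  qed
qed

text \<open>Minimality means that decreasing \<open>f\<close> along \<open>y\<close> changes nothing, so that
  \<open>f x \<le> f (x + y) - f y\<close>, which is the missing half of additivity.\<close>

lemma linear_of_minimal_sublinear:
  assumes f: "sublinear f"
    and min: "\<And>g. sublinear g \<Longrightarrow> (\<And>x. g x \<le> f x) \<Longrightarrow> g = f"
  shows "linear f"
proof -
  have add: "f (x + y) = f x + f y" for x y
  proof -
    obtain g where "sublinear g" "\<And>x. g x \<le> f x" "\<And>x. g x \<le> f (x + y) - f y"
      using sublinear_decrease[OF f] by metis
    then have "f x \<le> f (x + y) - f y"
      using min by metis
    with sublinear_add[OF f, of x y] show ?thesis
      by simp
  qed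
  have neg: "f (- x) = - f x" for x
    using add[of x "- x"] sublinear_zero[OF f] by simp
  have "f (r *\<^sub>R x) = r * f x" for r x
  proof (cases "0 \<le> r")
    case True
    then show ?thesis by (rule sublinear_scale[OF f])
  next
    case False
    then have "f (- ((- r) *\<^sub>R x)) = r * f x"
      unfolding neg by (subst sublinear_scale[OF f]) simp_all
    then show ?thesis by simp
  qed
  with add show ?thesis
    by (intro linearI) simp_all
qed

text \<open>Zorn's lemma applies downwards: the pointwise infimum of a chain stays above
  \<open>x \<mapsto> - q (- x)\<close>, hence is finite.\<close>

lemma minimal_sublinear_exists:
  assumes q: "sublinear q"
  obtains f where "sublinear f" "\<And>x. f x \<le> q x"
    "\<And>g. sublinear g \<Longrightarrow> (\<And>x. g x \<le> f x) \<Longrightarrow> g = f"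
proof -
  define S where "S = {f. sublinear f \<and> f \<le> q}"
  define P :: "('a \<Rightarrow> real) \<Rightarrow> ('a \<Rightarrow> real) \<Rightarrow> bool" where "P f g \<longleftrightarrow> g \<le> f" for f g
  have "\<exists>m\<in>S. \<forall>a\<in>S. P m a \<longrightarrow> a = m"
  proof (rule predicate_Zorn)
    show "partial_order_on S (relation_of P S)"
      by (rule partial_order_on_relation_ofI) (auto simp: P_def)
  next
    fix D assume D: "D \<in> Chains (relation_of P S)"
    then have DS: "D \<subseteq> S"
      by (rule Chains_relation_of)
    have total: "f \<le> g \<or> g \<le> f" if "f \<in> D" "g \<in> D" for f g
      using D that unfolding Chains_def relation_of_def P_def by blast
    show "\<exists>u\<in>S. \<forall>a\<in>D. P a u"
    proof (cases "D = {}")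
      case True
      then show ?thesis
        using q by (auto simp: S_def)
    next
      case False
      define A where "A x = (\<lambda>f. f x) ` D" for x
      have bdd: "bdd_below (A x)" for x
      proof (rule bdd_belowI)
        fix a assume "a \<in> A x"
        then obtain f where "f \<in> D" "a = f x"
          by (auto simp: A_def)
        with DS have "sublinear f" "f (- x) \<le> q (- x)" "a = f x"
          by (auto simp: S_def le_fun_def)
        then show "- q (- x) \<le> a"
          using sublinear_neg_le[of f x] by simp
      qed
      have lower: "Inf (A x) \<le> f x" if "f \<in> D" for f x
        using that by (intro cInf_lower[OF _ bdd]) (auto simp: A_def)
      have sub: "sublinear (\<lambda>x. Inf (A x))"
      proof (rule sublinear_Inf[OF _ bdd])
        show "A x \<noteq> {}" for x
          using False by (simp add: A_def)
      next
        fix x y a b assume "a \<in> A x" "b \<in> A y"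
        then obtain f g where fg: "f \<in> D" "a = f x" "g \<in> D" "b = g y"
          by (auto simp: A_def)
        then obtain h where h: "h \<in> D" "h x \<le> a" "h y \<le> b"
          using total[of f g] by (auto simp: le_fun_def)
        then have "h (x + y) \<le> a + b"
          using DS sublinear_add[of h x y] by (auto simp: S_def)
        with h(1) show "\<exists>c\<in>A (x + y). c \<le> a + b"
          by (auto simp: A_def)
      next
        fix x a and r :: real assume "a \<in> A x" and r: "0 < r"
        then obtain f where f: "f \<in> D" "a = f x"
          by (auto simp: A_def)
        then have eq: "r * a = f (r *\<^sub>R x)"
          using DS r by (auto simp: S_def sublinear_scale_pos)
        have "r * a \<in> A (r *\<^sub>R x)"
          unfolding A_def using eq f(1) by (rule image_eqI)
        then show "\<exists>c\<in>A (r *\<^sub>R x). c \<le> r * a"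
          by blast
      qed
      obtain f where "f \<in> D"
        using False by blast
      then have "Inf (A x) \<le> q x" for x
        using DS order_trans[OF lower[of f x], of "q x"] by (auto simp: S_def le_fun_def)
      with sub lower show ?thesis
        by (intro bexI[of _ "\<lambda>x. Inf (A x)"]) (auto simp: S_def P_def le_fun_def)
    qed
  qed
  then obtain f where f: "f \<in> S" "\<And>a. a \<in> S \<Longrightarrow> a \<le> f \<Longrightarrow> a = f"
    by (auto simp: P_def)
  show thesis
  proof
    show "sublinear f" "f x \<le> q x" for x
      using f(1) by (auto simp: S_def le_fun_def)
    fix g assume g: "sublinear g" "\<And>x. g x \<le> f x"
    then have "g \<le> f"
      by (simp add: le_fun_def)
    moreover from this have "g \<in> S"
      using f(1) g(1) by (auto simp: S_def)
    ultimately show "g = f"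
      by (rule f(2)[rotated])
  qed
qed

text \<open>Decreasing \<open>q\<close> along \<open>y\<close> first forces the linear functional below it to touch \<open>q\<close> at \<open>y\<close>.\<close>

theorem hahn_banach_sublinear:
  assumes q: "sublinear q"
  obtains f where "linear f" "\<And>x. f x \<le> q x" "f y = q y"
proof -
  obtain g where g: "sublinear g" "\<And>x. g x \<le> q x" "g (- y) \<le> - q y"
    using sublinear_decrease[OF q] by metis
  obtain f where f: "sublinear f" "\<And>x. f x \<le> g x"
    "\<And>h. sublinear h \<Longrightarrow> (\<And>x. h x \<le> f x) \<Longrightarrow> h = f"
    using minimal_sublinear_exists[OF g(1)] by metis
  have lin: "linear f"
    using linear_of_minimal_sublinear[OF f(1,3)] by blast
  have le: "f x \<le> q x" for x
    using f(2) g(2) by (rule order_trans)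
  have "- f y \<le> - q y"
    using f(2)[of "- y"] g(3) linear_neg[OF lin, of y] by simp
  with le[of y] have "f y = q y"
    by simp
  with lin le show thesis
    by (rule that)
qed

section \<open>Tangent cones and separation\<close>

lemma zero_in_tangent_cone: "p \<in> C \<Longrightarrow> 0 \<in> tangent_cone C p"
  by (auto simp: tangent_cone_def intro: exI[of _ 1])

lemma tangent_cone_scale:
  assumes "k \<in> tangent_cone C p" "0 < r"
  shows "r *\<^sub>R k \<in> tangent_cone C p"
proof -
  obtain t where "0 < t" "p + t *\<^sub>R k \<in> C"
    using assms(1) by (auto simp: tangent_cone_def)
  with assms(2) show ?thesis
    by (auto simp: tangent_cone_def intro!: exI[of _ "t / r"])
qed

lemma tangent_cone_add:
  assumes C: "convex C" and "k \<in> tangent_cone C p" "l \<in> tangent_cone C p"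
  shows "k + l \<in> tangent_cone C p"
proof -
  obtain s t where st: "0 < s" "p + s *\<^sub>R k \<in> C" "0 < t" "p + t *\<^sub>R l \<in> C"
    using assms(2,3) by (auto simp: tangent_cone_def)
  have sum1: "t / (s + t) + s / (s + t) = 1"
    using st by (simp add: add_divide_distrib[symmetric] add.commute)
  have "(t / (s + t)) *\<^sub>R (p + s *\<^sub>R k) + (s / (s + t)) *\<^sub>R (p + t *\<^sub>R l) \<in> C"
    using st sum1 by (intro convexD[OF C]) auto
  also have "(t / (s + t)) *\<^sub>R (p + s *\<^sub>R k) + (s / (s + t)) *\<^sub>R (p + t *\<^sub>R l)
      = (t / (s + t) + s / (s + t)) *\<^sub>R p + (s * t / (s + t)) *\<^sub>R (k + l)"
    by (simp add: scaleR_add_right scaleR_add_left mult.commute)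
  finally have "p + (s * t / (s + t)) *\<^sub>R (k + l) \<in> C"
    unfolding sum1 by simp
  then show ?thesis
    using st by (auto simp: tangent_cone_def intro!: exI[of _ "s * t / (s + t)"])
qed

text \<open>If a convex neighbourhood \<open>v + W\<close> of \<open>v\<close> misses \<open>K\<close>, then the gauge of \<open>W\<close> modulo \<open>K\<close>,
  namely the infimum of all \<open>s\<close> with \<open>x \<in> s *\<^sub>R W - K\<close>, is at least \<open>1\<close> at \<open>- v\<close>, while it is at
  most \<open>0\<close> on \<open>- K\<close> and at most \<open>1\<close> on \<open>W\<close>. A linear functional below it that agrees with it at
  \<open>- v\<close> separates \<open>v\<close> from \<open>K\<close>, and its boundedness on \<open>W\<close> makes it continuous.\<close>

lemma separate_convex_cone:
  fixes v :: "'a::locally_convex_space"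
  assumes K0: "0 \<in> K" and Kadd: "\<And>k l. k \<in> K \<Longrightarrow> l \<in> K \<Longrightarrow> k + l \<in> K"
    and Kscale: "\<And>k r. k \<in> K \<Longrightarrow> 0 < r \<Longrightarrow> r *\<^sub>R k \<in> K"
    and v: "v \<notin> closure K"
  obtains \<theta> where "\<theta> \<in> topological_dual" "\<And>k. k \<in> K \<Longrightarrow> 0 \<le> \<theta> k" "\<theta> v < 0"
proof -
  have "open (- closure K)" "v \<in> - closure K"
    using v by auto
  then obtain W where W: "convex W" "0 \<in> interior W"
    and "\<And>w. w \<in> W \<Longrightarrow> v + w \<in> - closure K"
    using convex_translate_nhds by metis
  then have disj: "v + w \<notin> K" if "w \<in> W" for w
    using that closure_subset[of K] by blast
  have W0: "0 \<in> W"
    using W(2) interior_subset by blast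
  define A where "A x = {s. 0 < s \<and> (\<exists>w\<in>W. \<exists>k\<in>K. x = s *\<^sub>R w - k)}" for x
  have memA: "s \<in> A (s *\<^sub>R w - k)" if "0 < s" "w \<in> W" "k \<in> K" for s w k
    using that by (auto simp: A_def)
  have bdd: "bdd_below (A x)" for x
    by (rule bdd_belowI[of _ 0]) (auto simp: A_def)
  have ne: "A x \<noteq> {}" for x
  proof -
    have "((\<lambda>n. inverse (real (Suc n)) *\<^sub>R x) \<longlongrightarrow> 0 *\<^sub>R x) sequentially"
      by (intro tendsto_scaleR_tvs LIMSEQ_inverse_real_of_nat tendsto_const)
    then have "\<forall>\<^sub>F n in sequentially. inverse (real (Suc n)) *\<^sub>R x \<in> interior W"
      using W(2) by (intro topological_tendstoD) auto
    then obtain n where n: "inverse (real (Suc n)) *\<^sub>R x \<in> W"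
      using interior_subset by (auto simp: eventually_sequentially)
    have "real (Suc n) \<in> A (real (Suc n) *\<^sub>R inverse (real (Suc n)) *\<^sub>R x - 0)"
      using n K0 by (intro memA) auto
    then show ?thesis
      by auto
  qed
  define q where "q x = Inf (A x)" for x
  have q: "sublinear q"
    unfolding q_def[abs_def]
  proof (rule sublinear_Inf[OF ne bdd])
    fix x y a b assume "a \<in> A x" "b \<in> A y"
    then obtain w k w' k' where *: "0 < a" "w \<in> W" "k \<in> K" "x = a *\<^sub>R w - k"
      "0 < b" "w' \<in> W" "k' \<in> K" "y = b *\<^sub>R w' - k'"
      by (auto simp: A_def)
    define w'' where "w'' = (a / (a + b)) *\<^sub>R w + (b / (a + b)) *\<^sub>R w'"
    have "w'' \<in> W"
      unfolding w''_def using *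
      by (intro convexD[OF W(1)]) (auto simp: add_divide_distrib[symmetric])
    then have "a + b \<in> A ((a + b) *\<^sub>R w'' - (k + k'))"
      using * by (intro memA Kadd) auto
    also have "(a + b) *\<^sub>R w'' - (k + k') = x + y"
      using * by (simp add: w''_def scaleR_add_right)
    finally show "\<exists>c\<in>A (x + y). c \<le> a + b"
      by auto
  next
    fix x a and r :: real assume "a \<in> A x" and r: "0 < r"
    then obtain w k where *: "0 < a" "w \<in> W" "k \<in> K" "x = a *\<^sub>R w - k"
      by (auto simp: A_def)
    then have "r * a \<in> A ((r * a) *\<^sub>R w - r *\<^sub>R k)"
      using r by (intro memA Kscale) auto
    also have "(r * a) *\<^sub>R w - r *\<^sub>R k = r *\<^sub>R x"
      using * by (simp add: scaleR_diff_right)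
    finally show "\<exists>c\<in>A (r *\<^sub>R x). c \<le> r * a"
      by auto
  qed
  have q_le: "q x \<le> s" if "s \<in> A x" for x s
    unfolding q_def using that bdd by (rule cInf_lower)
  have q_v: "1 \<le> q (- v)"
    unfolding q_def
  proof (rule cInf_greatest[OF ne])
    fix s assume "s \<in> A (- v)"
    then obtain w k where *: "0 < s" "w \<in> W" "k \<in> K" "- v = s *\<^sub>R w - k"
      by (auto simp: A_def)
    then have eq: "v + s *\<^sub>R w = k"
      by (simp add: algebra_simps add_eq_0_iff)
    show "1 \<le> s"
    proof (rule ccontr)
      assume "\<not> 1 \<le> s"
      then have "s *\<^sub>R w + (1 - s) *\<^sub>R 0 \<in> W"
        using * W0 by (intro convexD[OF W(1)]) auto
      then show False
        using disj eq *(3) by auto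
    qed
  qed
  obtain f where lin: "linear f" and f_le: "\<And>x. f x \<le> q x" and f_v: "f (- v) = q (- v)"
    using hahn_banach_sublinear[OF q] by metis
  show thesis
  proof
    have "f w \<le> 1" if "w \<in> W" for w
      using f_le[of w] q_le[OF memA[of 1 w 0]] that K0 by simp
    then show "f \<in> topological_dual"
      using lin continuous_on_linear_bounded_above_nhds[OF lin W(2)]
      by (simp add: topological_dual_def)
  next
    fix k assume k: "k \<in> K"
    have "f (- k) \<le> 0"
    proof (rule field_le_epsilon)
      fix s :: real assume "0 < s"
      then show "f (- k) \<le> 0 + s"
        using f_le[of "- k"] q_le[OF memA[of s 0 k]] W0 k by simp
    qed
    then show "0 \<le> f k"
      by (simp add: linear_neg[OF lin])
  next
    show "f v < 0"
      using f_v q_v by (simp add: linear_neg[OF lin])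
  qed
qed

lemma minimum_iff_nonneg_on_tangent_cone:
  assumes lin: "linear \<theta>" and C: "convex C" "p \<in> C"
  shows "ereal (\<theta> p) = (INF q\<in>C. ereal (\<theta> q)) \<longleftrightarrow> (\<forall>k\<in>tangent_cone C p. 0 \<le> \<theta> k)"
proof -
  have "ereal (\<theta> p) = (INF q\<in>C. ereal (\<theta> q)) \<longleftrightarrow> (\<forall>q\<in>C. \<theta> p \<le> \<theta> q)"
  proof
    assume "ereal (\<theta> p) = (INF q\<in>C. ereal (\<theta> q))"
    then show "\<forall>q\<in>C. \<theta> p \<le> \<theta> q"
      by (metis INF_lower ereal_less_eq(3))
  next
    assume "\<forall>q\<in>C. \<theta> p \<le> \<theta> q"
    then show "ereal (\<theta> p) = (INF q\<in>C. ereal (\<theta> q))"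
      using C(2) by (intro antisym INF_greatest INF_lower2[of p]) auto
  qed
  also have "\<dots> \<longleftrightarrow> (\<forall>k\<in>tangent_cone C p. 0 \<le> \<theta> k)"
  proof
    assume *: "\<forall>q\<in>C. \<theta> p \<le> \<theta> q"
    show "\<forall>k\<in>tangent_cone C p. 0 \<le> \<theta> k"
    proof
      fix k assume "k \<in> tangent_cone C p"
      then obtain t where t: "0 < t" "p + t *\<^sub>R k \<in> C"
        by (auto simp: tangent_cone_def)
      then have "\<theta> p \<le> \<theta> (p + t *\<^sub>R k)"
        using * by blast
      then show "0 \<le> \<theta> k"
        using t(1) by (simp add: linear_add[OF lin] linear_scale[OF lin] zero_le_mult_iff)
    qed
  next
    assume *: "\<forall>k\<in>tangent_cone C p. 0 \<le> \<theta> k"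
    show "\<forall>q\<in>C. \<theta> p \<le> \<theta> q"
    proof
      fix q assume "q \<in> C"
      then have "q - p \<in> tangent_cone C p"
        by (auto simp: tangent_cone_def intro: exI[of _ 1])
      with * show "\<theta> p \<le> \<theta> q"
        by (force simp: linear_diff[OF lin])
    qed
  qed
  finally show ?thesis .
qed

section \<open>Curves with a prescribed initial velocity\<close>

lemma closure_sequence_of_norm_inducing:
  assumes N: "norm_inducing X N" and "v \<in> X" "A \<subseteq> X" "v \<in> closure A"
  obtains w where "\<And>n::nat. w n \<in> A" "w \<longlonglongrightarrow> v"
proof -
  have "norm_on (span X) N" and top: "Metric_space.mtopology X (norm_dist X N) = top_of_set X"
    using N by (auto simp: norm_inducing_def)
  then interpret M: Metric_space X "norm_dist X N"
    by (intro Metric_space_norm_dist)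
  have "v \<in> M.mtopology closure_of A"
    using assms(2-4) by (simp add: top closure_of_subtopology Int_absorb1)
  then obtain w where "range w \<subseteq> A" "limitin M.mtopology w v sequentially"
    unfolding M.closure_of_sequentially by blast
  then show thesis
    using that[of w] by (auto simp: top limitin_subtopology)
qed

text \<open>Written as a telescoping sum, with coefficients that grow from \<open>0\<close> to \<open>1\<close> as \<open>t\<close> decreases
  from \<open>s n\<close> to \<open>s (Suc n)\<close>, the path is a finite sum of continuous terms on every set
  \<open>{s m<..}\<close>; this gives continuity without gluing.\<close>

lemma piecewise_linear_interpolation:
  fixes w :: "nat \<Rightarrow> 'a::topological_real_vector" and s :: "nat \<Rightarrow> real"
  assumes dec: "\<And>n. s (Suc n) < s n" and lim: "s \<longlonglongrightarrow> 0"
  obtains u where "continuous_on {0<..} u"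
    and "\<And>n t. s (Suc n) \<le> t \<Longrightarrow> t \<le> s n \<Longrightarrow> u t \<in> closed_segment (w n) (w (Suc n))"
proof -
  have "decseq s"
    by (intro decseq_SucI less_imp_le dec)
  then have mono: "s n \<le> s m" if "m \<le> n" for m n
    using that by (rule decseqD)
  define \<rho> where "\<rho> n t = max 0 (min 1 ((s n - t) / (s n - s (Suc n))))" for n t
  have \<rho>0: "\<rho> n t = 0" if "s n \<le> t" for n t
  proof -
    have "(s n - t) / (s n - s (Suc n)) \<le> 0"
      using that dec[of n] by (intro divide_nonpos_pos) simp_all
    then show ?thesis
      unfolding \<rho>_def by linarith
  qed
  have \<rho>1: "\<rho> n t = 1" if "t \<le> s (Suc n)" for n t
  proof -
    have "1 \<le> (s n - t) / (s n - s (Suc n))"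
      using that dec[of n] by (subst le_divide_eq_1_pos) simp_all
    then show ?thesis
      unfolding \<rho>_def by linarith
  qed
  have \<rho>_cont: "continuous_on S (\<rho> n)" for S n
    unfolding \<rho>_def using dec[of n]
    by (intro continuous_on_max continuous_on_min continuous_on_divide continuous_on_diff
        continuous_on_const continuous_on_id) auto
  define d where "d n = w (Suc n) - w n" for n
  define u where "u t = w 0 + (\<Sum>n | t < s n. \<rho> n t *\<^sub>R d n)" for t
  have u_eq: "u t = w 0 + (\<Sum>n<m. \<rho> n t *\<^sub>R d n)" if "s m \<le> t" for m t
  proof -
    have "n < m" if "t < s n" for n
    proof (rule ccontr)
      assume "\<not> n < m"
      then have "s n \<le> s m"
        by (intro mono) simp
      with \<open>s m \<le> t\<close> \<open>t < s n\<close> show False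
        by simp
    qed
    then have "{n. t < s n} \<subseteq> {..<m}"
      by blast
    then have "(\<Sum>n | t < s n. \<rho> n t *\<^sub>R d n) = (\<Sum>n<m. \<rho> n t *\<^sub>R d n)"
      by (intro sum.mono_neutral_left) (auto simp: \<rho>0)
    then show ?thesis
      by (simp add: u_def)
  qed
  show thesis
  proof
    have "isCont u t" if "0 < t" for t
    proof -
      from order_tendstoD(2)[OF lim that] obtain m where m: "s m < t"
        by (auto simp: eventually_sequentially)
      have "continuous_on {s m<..} (\<lambda>t. w 0 + (\<Sum>n<m. \<rho> n t *\<^sub>R d n))"
        by (intro continuous_on_add continuous_on_sum continuous_on_scaleR_tvs continuous_on_const
            \<rho>_cont)
      then have "continuous_on {s m<..} u"
        by (subst continuous_on_cong[OF refl u_eq]) auto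
      then show ?thesis
        using m by (simp add: continuous_on_eq_continuous_at)
    qed
    then show "continuous_on {0<..} u"
      by (simp add: continuous_at_imp_continuous_on)
  next
    fix n t assume t: "s (Suc n) \<le> t" "t \<le> s n"
    have "(\<Sum>i<n. \<rho> i t *\<^sub>R d i) = (\<Sum>i<n. d i)"
    proof (rule sum.cong[OF refl])
      fix i assume "i \<in> {..<n}"
      then have "t \<le> s (Suc i)"
        using t(2) mono[of "Suc i" n] by auto
      then show "\<rho> i t *\<^sub>R d i = d i"
        by (simp add: \<rho>1)
    qed
    also have "\<dots> = w n - w 0"
      unfolding d_def by (rule sum_lessThan_telescope)
    finally have "u t = w n + \<rho> n t *\<^sub>R (w (Suc n) - w n)"
      using u_eq[OF t(1)] by (simp add: d_def)
    also have "\<dots> = (1 - \<rho> n t) *\<^sub>R w n + \<rho> n t *\<^sub>R w (Suc n)"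
      by (simp add: algebra_simps)
    finally show "u t \<in> closed_segment (w n) (w (Suc n))"
      unfolding in_segment by (intro exI[of _ "\<rho> n t"]) (auto simp: \<rho>_def)
  qed
qed

lemma decreasing_null_sequence_cell:
  fixes s :: "nat \<Rightarrow> real"
  assumes "s \<longlonglongrightarrow> 0" "0 < t" "t \<le> s 0"
  obtains n where "s (Suc n) < t" "t \<le> s n"
proof -
  from order_tendstoD(2)[OF assms(1,2)] obtain m where "s m < t"
    by (auto simp: eventually_sequentially)
  then have "s (LEAST m. s m < t) < t"
    by (rule LeastI)
  moreover obtain n where n: "(LEAST m. s m < t) = Suc n"
    using calculation assms(3) by (cases "LEAST m. s m < t") auto
  ultimately show thesis
    using that[of n] not_less_Least[of n "\<lambda>m. s m < t"] by auto
qed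

text \<open>The local convexity of the space is what lets the intermediate directions converge together
  with the directions \<open>w n\<close> that they join.\<close>

lemma tendsto_interpolation:
  fixes w :: "nat \<Rightarrow> 'a::locally_convex_space" and s :: "nat \<Rightarrow> real"
  assumes w: "w \<longlonglongrightarrow> v" and s: "decseq s" "s \<longlonglongrightarrow> 0" "\<And>n. 0 < s n"
    and u: "\<And>n t. s (Suc n) \<le> t \<Longrightarrow> t \<le> s n \<Longrightarrow> u t \<in> closed_segment (w n) (w (Suc n))"
  shows "(u \<longlongrightarrow> v) (at_right 0)"
proof (rule topological_tendstoI)
  fix T assume T: "open T" "v \<in> T"
  obtain W where W: "convex W" "0 \<in> interior W" "\<And>x. x \<in> W \<Longrightarrow> v + x \<in> T"
    using convex_translate_nhds[OF T] by metis
  have "(\<lambda>n. w n - v) \<longlonglongrightarrow> v - v"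
    by (intro tendsto_intros w)
  then have "\<forall>\<^sub>F n in sequentially. w n - v \<in> interior W"
    using W(2) by (intro topological_tendstoD) auto
  then obtain m where m: "\<And>n. m \<le> n \<Longrightarrow> w n - v \<in> W"
    using interior_subset by (auto simp: eventually_sequentially)
  have conv: "convex ((+) v ` W)"
    using W(1) by (rule convex_translation)
  have wm: "w n \<in> (+) v ` W" if "m \<le> n" for n
    by (rule image_eqI[OF _ m[OF that]]) simp
  have "u t \<in> T" if t: "0 < t" "t < s m" for t
  proof -
    have "t \<le> s 0"
      using t(2) decseqD[OF s(1), of 0 m] by simp
    then obtain n where n: "s (Suc n) < t" "t \<le> s n"
      using decreasing_null_sequence_cell[OF s(2) t(1)] by metis
    have "m \<le> n"
    proof (rule ccontr)
      assume "\<not> m \<le> n"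
      then have "s m \<le> s (Suc n)"
        using decseqD[OF s(1), of "Suc n" m] by simp
      with n t show False by simp
    qed
    then have "closed_segment (w n) (w (Suc n)) \<subseteq> (+) v ` W"
      by (intro closed_segment_subset wm conv) auto
    then show "u t \<in> T"
      using u[of n t] n W(3) by fastforce
  qed
  then show "\<forall>\<^sub>F t in at_right 0. u t \<in> T"
    unfolding eventually_at_right[OF s(3)[of m]] using s(3)[of m] by blast
qed

lemma small_multiples_in_convex:
  assumes C: "convex C" "p \<in> C" and "p + \<tau> *\<^sub>R k \<in> C" "0 < \<tau>" "0 \<le> t" "t \<le> \<tau>"
  shows "p + t *\<^sub>R k \<in> C"
proof -
  have "(1 - t / \<tau>) *\<^sub>R p + (t / \<tau>) *\<^sub>R (p + \<tau> *\<^sub>R k) \<in> C"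
    using assms by (intro convexD[OF C(1)]) auto
  then show ?thesis
    using assms(4) by (simp add: algebra_simps)
qed

lemma curve_of_tangent_sequence:
  fixes C :: "'a::locally_convex_space set"
  assumes C: "convex C" "p \<in> C" and w: "\<And>n. w n \<in> tangent_cone C p" "w \<longlonglongrightarrow> v"
  obtains c where "continuous_on {0..} c" "c ` {0..} \<subseteq> C" "c 0 = p"
    "((\<lambda>t. (c t - c 0) /\<^sub>R t) \<longlongrightarrow> v) (at_right 0)"
proof -
  obtain \<tau> where \<tau>: "\<And>n. 0 < \<tau> n" "\<And>n. p + \<tau> n *\<^sub>R w n \<in> C"
    using w(1) unfolding tangent_cone_def mem_Collect_eq by metis
  \<comment> \<open>The minimum reaches up to \<open>Suc n\<close> because both ends of the \<open>n\<close>-th piece have to stay in \<open>C\<close>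
    up to time \<open>s n\<close>; the factor makes the sequence strictly decreasing with limit \<open>0\<close>.\<close>
  define \<mu> where "\<mu> n = Min (\<tau> ` {..Suc n})" for n
  define s where "s n = \<mu> n * (1 / 2) ^ n" for n
  have \<mu>_pos: "0 < \<mu> n" for n
    using \<tau>(1) by (simp add: \<mu>_def)
  have \<mu>_dec: "\<mu> (Suc n) \<le> \<mu> n" for n
    unfolding \<mu>_def by (rule Min_antimono) auto
  have \<mu>_le: "\<mu> n \<le> \<tau> n" "\<mu> n \<le> \<tau> (Suc n)" for n
    unfolding \<mu>_def by (auto intro!: Min_le)
  have s_pos: "0 < s n" for n
    using \<mu>_pos by (simp add: s_def)
  have s_le: "s n \<le> \<mu> n" for n
    using \<mu>_pos[of n] by (simp add: s_def mult_left_le power_le_one)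
  have s_dec: "s (Suc n) < s n" for n
    using \<mu>_dec[of n] \<mu>_pos[of n] by (simp add: s_def)
  have decs: "decseq s"
    using s_dec by (intro decseq_SucI less_imp_le)
  have s_lim: "s \<longlonglongrightarrow> 0"
  proof (rule tendsto_sandwich[OF _ _ tendsto_const])
    have "\<mu> n \<le> \<mu> 0" for n
      by (rule decseqD[OF decseq_SucI[of \<mu>, OF \<mu>_dec]]) simp
    then show "\<forall>\<^sub>F n in sequentially. s n \<le> \<mu> 0 * (1 / 2) ^ n"
      by (simp add: s_def)
    have "(\<lambda>n. \<mu> 0 * (1 / 2) ^ n) \<longlonglongrightarrow> \<mu> 0 * 0"
      by (intro tendsto_intros LIMSEQ_realpow_zero) auto
    then show "(\<lambda>n. \<mu> 0 * (1 / 2) ^ n) \<longlonglongrightarrow> 0"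
      by simp
  qed (simp add: less_imp_le[OF s_pos])
  obtain u where u_cont: "continuous_on {0<..} u"
    and u_seg: "\<And>n t. s (Suc n) \<le> t \<Longrightarrow> t \<le> s n \<Longrightarrow> u t \<in> closed_segment (w n) (w (Suc n))"
    using piecewise_linear_interpolation[OF s_dec s_lim, of w] by metis
  have u_lim: "(u \<longlongrightarrow> v) (at_right 0)"
    by (rule tendsto_interpolation[OF w(2) decs s_lim s_pos]) (rule u_seg)
  have in_C: "p + t *\<^sub>R u t \<in> C" if t: "0 \<le> t" "t \<le> s 0" for t
  proof (cases "t = 0")
    case False
    with t obtain n where n: "s (Suc n) < t" "t \<le> s n"
      using decreasing_null_sequence_cell[OF s_lim, of t] by (metis less_eq_real_def)
    have "t \<le> \<mu> n"
      using n(2) s_le[of n] by simp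
    then have ends: "p + t *\<^sub>R w n \<in> C" "p + t *\<^sub>R w (Suc n) \<in> C"
      using \<mu>_le[of n] t
      by (auto intro!: small_multiples_in_convex[OF C \<tau>(2) \<tau>(1)])
    obtain r where r: "0 \<le> r" "r \<le> 1" "u t = (1 - r) *\<^sub>R w n + r *\<^sub>R w (Suc n)"
      using u_seg[of n t] n by (auto simp: in_segment)
    have "(1 - r) *\<^sub>R (p + t *\<^sub>R w n) + r *\<^sub>R (p + t *\<^sub>R w (Suc n)) \<in> C"
      using r ends by (intro convexD[OF C(1)]) auto
    then show ?thesis
      by (simp add: r(3) algebra_simps)
  qed (use C in simp)
  define g where "g t = p + t *\<^sub>R u t" for t
  have g_cont: "continuous_on {0..s 0} g"
    unfolding continuous_on_def
  proof
    fix t assume "t \<in> {0..s 0}"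
    then consider "t = 0" | "0 < t"
      by force
    then show "(g \<longlongrightarrow> g t) (at t within {0..s 0})"
    proof cases
      case 1
      have "((\<lambda>t. p + t *\<^sub>R u t) \<longlongrightarrow> p + 0 *\<^sub>R v) (at_right 0)"
        by (intro tendsto_add tendsto_scaleR_tvs tendsto_const u_lim tendsto_ident_at)
      then show ?thesis
        using 1 s_pos[of 0] by (simp add: g_def[abs_def] at_within_Icc_at_right)
    next
      case 2
      have "continuous_on {0<..} g"
        unfolding g_def[abs_def]
        by (intro continuous_on_add continuous_on_scaleR_tvs continuous_on_const continuous_on_id
            u_cont)
      then have "isCont g t"
        using 2 by (simp add: continuous_on_eq_continuous_at)
      then show ?thesis
        unfolding isCont_def by (rule tendsto_within_subset) simp
    qed
  qed
  show thesis
  proof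
    show "continuous_on {0..} (\<lambda>t. g (min t (s 0)))"
      by (rule continuous_on_compose2[OF g_cont])
        (use s_pos[of 0] in \<open>auto intro!: continuous_intros\<close>)
    show "(\<lambda>t. g (min t (s 0))) ` {0..} \<subseteq> C"
      using in_C s_pos[of 0] by (auto simp: g_def)
    show "g (min 0 (s 0)) = p"
      using s_pos[of 0] by (simp add: g_def)
    have "\<forall>\<^sub>F t in at_right 0. u t = (g (min t (s 0)) - g (min 0 (s 0))) /\<^sub>R t"
      unfolding eventually_at_right[OF s_pos[of 0]]
      using s_pos[of 0] by (intro exI[of _ "s 0"]) (auto simp: g_def)
    with u_lim show "((\<lambda>t. (g (min t (s 0)) - g (min 0 (s 0))) /\<^sub>R t) \<longlongrightarrow> v) (at_right 0)"
      by (rule Lim_transform_eventually)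
  qed
qed

theorem corollary3:
  fixes C X :: "'a::locally_convex_space set" and p v :: 'a
  assumes "convex C" and "p \<in> C"
    and "v \<in> X" and "C \<subseteq> X"
    and "\<exists>N. norm_inducing X N"
    and "\<exists>U. open U \<and> v \<in> U \<and> tangent_cone C p \<inter> U \<subseteq> X"
  shows "(\<exists>c :: real \<Rightarrow> 'a.
            continuous_on {0..} c \<and> c ` {0..} \<subseteq> C \<and> c 0 = p \<and>
            ((\<lambda>t. (c t - c 0) /\<^sub>R t) \<longlongrightarrow> v) (at_right 0))
     \<longleftrightarrow> (\<forall>\<theta>\<in>topological_dual. ereal (\<theta> p) = (INF q\<in>C. ereal (\<theta> q)) \<longrightarrow> 0 \<le> \<theta> v)"
    (is "?curve \<longleftrightarrow> ?functionals")
proof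
  assume ?curve
  then obtain c where c: "c ` {0..} \<subseteq> C" "c 0 = p"
    "((\<lambda>t. (c t - c 0) /\<^sub>R t) \<longlongrightarrow> v) (at_right 0)"
    by blast
  show ?functionals
  proof (intro ballI impI)
    fix \<theta> assume \<theta>: "\<theta> \<in> topological_dual" and min: "ereal (\<theta> p) = (INF q\<in>C. ereal (\<theta> q))"
    then have lin: "linear \<theta>" and cont: "continuous_on UNIV \<theta>"
      by (auto simp: topological_dual_def)
    have lim: "((\<lambda>t. \<theta> ((c t - c 0) /\<^sub>R t)) \<longlongrightarrow> \<theta> v) (at_right 0)"
      by (rule continuous_on_tendsto_compose[OF cont c(3)]) auto
    have "0 \<le> \<theta> ((c t - c 0) /\<^sub>R t)" if "0 < t" for t
    proof -
      have "(c t - c 0) /\<^sub>R t \<in> tangent_cone C p"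
        using c(1,2) that by (auto simp: tangent_cone_def intro!: exI[of _ t])
      with min show ?thesis
        using minimum_iff_nonneg_on_tangent_cone[OF lin assms(1,2)] by blast
    qed
    then have "\<forall>\<^sub>F t in at_right 0. 0 \<le> \<theta> ((c t - c 0) /\<^sub>R t)"
      by (simp add: eventually_at_filter)
    with lim show "0 \<le> \<theta> v"
      by (rule tendsto_lowerbound) simp
  qed
next
  assume functionals: ?functionals
  obtain N U where N: "norm_inducing X N"
    and U: "open U" "v \<in> U" "U \<inter> tangent_cone C p \<subseteq> X"
    using assms(5,6) by blast
  have "v \<in> closure (tangent_cone C p)"
  proof (rule ccontr)
    assume "v \<notin> closure (tangent_cone C p)"
    then obtain \<theta> where \<theta>: "\<theta> \<in> topological_dual" "\<And>k. k \<in> tangent_cone C p \<Longrightarrow> 0 \<le> \<theta> k" "\<theta> v < 0"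
      using separate_convex_cone[OF zero_in_tangent_cone[OF assms(2)]
          tangent_cone_add[OF assms(1)] tangent_cone_scale] by metis
    then have "ereal (\<theta> p) = (INF q\<in>C. ereal (\<theta> q))"
      using minimum_iff_nonneg_on_tangent_cone[OF _ assms(1,2)] by (auto simp: topological_dual_def)
    with functionals \<theta> show False
      by fastforce
  qed
  then have "v \<in> closure (U \<inter> tangent_cone C p)"
    using open_Int_closure_subset[OF U(1)] U(2) by blast
  then obtain w where "\<And>n. w n \<in> U \<inter> tangent_cone C p" "w \<longlonglongrightarrow> v"
    using closure_sequence_of_norm_inducing[OF N assms(3) U(3)] by metis
  then show ?curve
    using curve_of_tangent_sequence[OF assms(1,2), of w v] by (metis IntD2)
qed

end
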